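(* For every integer $p\ge 1$, $$A\left(\frac{p}{2p+1}\right)=\frac{\cos\left(\frac{\pi}{2p+1}\right)}{1+\cos\left(\frac{\pi}{2p+1}\right)}.$$
   Context: For $0<h\le 1/2$, $K(h)$ denotes the class of continuous $1$-periodic even functions $f:\mathbb{R}\to\mathbb{R}$ such that: (1) $f(x)=\sum_{n=0}^{\infty}a_n\cos(2\pi nx)$; (2) $a_n\ge 0$ for all $n=0,1,2,\dots$; (3) $f(0)=\sum_{n=0}^{\infty}a_n=1$; (4) $f(x)=0$ for $h\le |x|\le 1/2$. Define $A(h)=\sup_{f\in K(h)}a_0=\sup_{f\in K(h)}\int_{-h}^{h}f(x)\,dx$. *)

theory Defs
  imports "HOL-Analysis.Analysis"
begin

definition cos_expansion :: "(real \<Rightarrow> real) \<Rightarrow> (nat \<Rightarrow> real) \<Rightarrow> bool" where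
  "cos_expansion f a \<longleftrightarrow>
     (\<forall>x. (\<lambda>n. a n * cos (2 * pi * real n * x)) sums f x) \<and>
     (\<forall>n. a n \<ge> 0) \<and>
     f 0 = 1 \<and> a sums 1"

definition K :: "real \<Rightarrow> (real \<Rightarrow> real) set" where
  "K h = {f. continuous_on UNIV f \<and>
             (\<forall>x. f (x + 1) = f x) \<and>
             (\<forall>x. f (- x) = f x) \<and>
             (\<exists>a. cos_expansion f a) \<and>
             (\<forall>x. h \<le> \<bar>x\<bar> \<and> \<bar>x\<bar> \<le> 1/2 \<longrightarrow> f x = 0)}"

(* The coefficients a are determined by f (lemma cos_expansion_unique), so a 0 really is a
   functional of f; lemma A_eq_Sup_integral gives the description by integrals
   (for 0 < h <= 1/2). The real Sup is meaningful because the set is bounded (A_bdd_above). *)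
definition A :: "real \<Rightarrow> real" where
  "A h = Sup {a 0 | f a. f \<in> K h \<and> cos_expansion f a}"

lemma cos_expansion_0_le_1:
  assumes "cos_expansion f a"
  shows "a 0 \<le> 1"
proof -
  have "sum a {..<1} \<le> suminf a"
    using assms by (intro sum_le_suminf) (auto simp: cos_expansion_def sums_iff)
  then show ?thesis
    using assms by (simp add: cos_expansion_def sums_iff)
qed

lemma A_bdd_above: "bdd_above {a 0 | f a. f \<in> K h \<and> cos_expansion f a}"
  using cos_expansion_0_le_1 by (intro bdd_aboveI[of _ 1]) blast

lemma integral_cos_cos:
  "((\<lambda>x. cos (2 * pi * real n * x) * cos (2 * pi * real m * x)) has_integral
     (if n = m then if m = 0 then 1 else 1/2 else 0)) {-1/2..1/2}"
proof -
  have base: "((\<lambda>x. cos (2 * pi * of_int k * x)) has_integral (if k = 0 then 1 else 0)) {-1/2..1/2::real}"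
    for k :: int
  proof (cases "k = 0")
    case True
    have "((\<lambda>x. 1::real) has_integral 1) {-1/2..1/2::real}"
      using has_integral_const_real[of "1::real" "-1/2" "1/2"] by simp
    with True show ?thesis by simp
  next
    case False
    let ?F = "\<lambda>x. sin (2 * pi * of_int k * x) / (2 * pi * of_int k)"
    have "((\<lambda>x. cos (2 * pi * of_int k * x)) has_integral (?F (1/2) - ?F (-1/2))) {-1/2..1/2::real}"
      using False
      by (intro fundamental_theorem_of_calculus)
        (auto intro!: derivative_eq_intros simp flip: has_real_derivative_iff_has_vector_derivative)
    moreover have "sin (pi * of_int k) = 0"
      by (simp add: mult.commute sin_zero_iff_int2)
    ultimately show ?thesis
      using False by simp
  qed
  have "((\<lambda>x. (cos (2 * pi * of_int (int n - int m) * x) + cos (2 * pi * of_int (int n + int m) * x)) / 2)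
      has_integral ((if int n - int m = 0 then 1 else 0) + (if int n + int m = 0 then 1 else 0)) / 2)
      {-1/2..1/2::real}"
    by (intro has_integral_divide has_integral_add base)
  moreover have "(\<lambda>x::real. (cos (2 * pi * of_int (int n - int m) * x) + cos (2 * pi * of_int (int n + int m) * x)) / 2)
     = (\<lambda>x. cos (2 * pi * real n * x) * cos (2 * pi * real m * x))"
  proof
    fix x :: real
    have "cos (2 * pi * of_int (int n - int m) * x) = cos (2 * pi * real n * x - 2 * pi * real m * x)"
      "cos (2 * pi * of_int (int n + int m) * x) = cos (2 * pi * real n * x + 2 * pi * real m * x)"
      by (simp_all add: algebra_simps)
    then show "(cos (2 * pi * of_int (int n - int m) * x) + cos (2 * pi * of_int (int n + int m) * x)) / 2
        = cos (2 * pi * real n * x) * cos (2 * pi * real m * x)"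
      by (simp only: cos_times_cos)
  qed
  moreover have "((if int n - int m = 0 then 1 else 0) + (if int n + int m = 0 then 1 else 0)) / 2
      = (if n = m then if m = 0 then 1 else 1/2 else (0::real))"
    by auto
  ultimately show ?thesis
    by (simp only:)
qed

lemma cos_expansion_has_integral:
  assumes "cos_expansion f a"
  shows "((\<lambda>x. f x * cos (2 * pi * real m * x)) has_integral
          (if m = 0 then a 0 else a m / 2)) {-1/2..1/2}"
proof -
  let ?g = "\<lambda>n x. a n * cos (2 * pi * real n * x) * cos (2 * pi * real m * x)"
  let ?I = "\<lambda>n. (if n = m then if m = 0 then a 0 else a m / 2 else 0)"
  let ?S = "{-1/2..1/2::real}"
  have s: "\<And>x. (\<lambda>n. ?g n x) sums (f x * cos (2 * pi * real m * x))"
    using assms by (intro sums_mult2) (auto simp: cos_expansion_def)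
  have "norm (?g n x) \<le> a n" for n x
  proof -
    have "\<bar>cos (2 * pi * real n * x)\<bar> * \<bar>cos (2 * pi * real m * x)\<bar> \<le> 1 * 1"
      by (intro mult_mono) auto
    then have "a n * (\<bar>cos (2 * pi * real n * x)\<bar> * \<bar>cos (2 * pi * real m * x)\<bar>) \<le> a n * 1"
      using assms by (intro mult_left_mono) (auto simp: cos_expansion_def)
    then show ?thesis
      using assms by (simp add: cos_expansion_def abs_mult mult.assoc)
  qed
  moreover have "summable a"
    using assms by (auto simp: cos_expansion_def sums_iff)
  ultimately have "uniform_limit ?S (\<lambda>N x. \<Sum>n<N. ?g n x) (\<lambda>x. \<Sum>n. ?g n x) sequentially"
    by (intro Weierstrass_m_test)
  then have ul: "uniform_limit ?S (\<lambda>N x. \<Sum>n<N. ?g n x) (\<lambda>x. f x * cos (2 * pi * real m * x)) sequentially"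
    using s by (simp add: sums_iff)
  have I: "((\<lambda>x. \<Sum>n<N. ?g n x) has_integral (\<Sum>n<N. ?I n)) ?S" for N
  proof (intro has_integral_sum)
    fix n
    show "((\<lambda>x. ?g n x) has_integral ?I n) ?S"
      using has_integral_mult_right[OF integral_cos_cos[of n m], of "a n"]
      by (auto simp: mult.assoc split: if_splits)
  qed auto
  obtain I J where IJ: "\<And>N. ((\<lambda>x. \<Sum>n<N. ?g n x) has_integral I N) ?S"
      "((\<lambda>x. f x * cos (2 * pi * real m * x)) has_integral J) ?S" "(I \<longlongrightarrow> J) sequentially"
    by (rule uniform_limit_integral[OF ul]) (auto intro!: continuous_intros)
  have "I = (\<lambda>N. \<Sum>n<N. ?I n)"
    using has_integral_unique[OF IJ(1) I] by (rule ext)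
  with IJ(3) have "?I sums J"
    by (simp only: sums_def)
  moreover have "?I sums (if m = 0 then a 0 else a m / 2)"
    by (rule sums_single)
  ultimately have "J = (if m = 0 then a 0 else a m / 2)"
    by (rule sums_unique2)
  with IJ(2) show ?thesis
    by (simp only:)
qed

lemma cos_expansion_unique:
  assumes "cos_expansion f a" "cos_expansion f b"
  shows "a = b"
proof
  fix m
  show "a m = b m"
    using has_integral_unique[OF assms[THEN cos_expansion_has_integral, of m]]
    by (simp split: if_splits)
qed

lemma cos_expansion_0_eq_integral:
  assumes "f \<in> K h" "cos_expansion f a" "0 < h" "h \<le> 1/2"
  shows "a 0 = integral {-h..h} f"
proof -
  have *: "(f has_integral a 0) {-1/2..1/2}"
    using cos_expansion_has_integral[OF assms(2), of 0] by simp
  have "((\<lambda>x. if x \<in> {-h..h} then f x else 0) has_integral a 0) {-1/2..1/2}"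
    using assms by (intro has_integral_eq[OF _ *]) (auto simp: K_def)
  then have "(f has_integral a 0) {-h..h}"
    using assms by (subst (asm) has_integral_restrict) auto
  then show ?thesis by (simp add: integral_unique)
qed

lemma A_eq_Sup_integral:
  assumes "0 < h" "h \<le> 1/2"
  shows "A h = (SUP f\<in>K h. integral {-h..h} f)"
proof -
  have "{a 0 | f a. f \<in> K h \<and> cos_expansion f a} = (\<lambda>f. integral {-h..h} f) ` K h"
  proof (intro subset_antisym subsetI)
    fix y assume "y \<in> {a 0 | f a. f \<in> K h \<and> cos_expansion f a}"
    then obtain f a where "y = a 0" "f \<in> K h" "cos_expansion f a"
      by blast
    then show "y \<in> (\<lambda>f. integral {-h..h} f) ` K h"
      using cos_expansion_0_eq_integral[OF _ _ assms] by blast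
  next
    fix y assume "y \<in> (\<lambda>f. integral {-h..h} f) ` K h"
    then obtain f where f: "f \<in> K h" "y = integral {-h..h} f"
      by blast
    then obtain a where a: "cos_expansion f a"
      unfolding K_def by blast
    then have "y = a 0"
      using cos_expansion_0_eq_integral[OF f(1) a assms] f(2) by simp
    then show "y \<in> {a 0 | f a. f \<in> K h \<and> cos_expansion f a}"
      using f(1) a by blast
  qed
  then show ?thesis by (simp add: A_def)
qed

end

theory Submission
  imports Defs
begin

text \<open>
  Put \<open>q = 2p + 1\<close> and \<open>C = cos (\<pi>/q)\<close>, and let \<open>h = p/q\<close>.

  Upper bound. The numbers \<open>2\<pi>np/q\<close> are, modulo \<open>2\<pi>\<close>, multiples of \<open>2\<pi>/q\<close>, and as \<open>q\<close> is odd
  none of these comes closer to \<open>\<pi>\<close> than \<open>\<pi>/q\<close>. So every \<open>cos (2\<pi>nh)\<close> is at least \<open>-C\<close>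
  (\<open>cos_multiples_ge\<close>), and evaluating the series at the single point \<open>h\<close> gives
  \<open>0 = f h \<ge> a\<^sub>0 - C (1 - a\<^sub>0)\<close>, that is \<open>a\<^sub>0 \<le> C / (1 + C) =: t\<close>.

  Attainment. Equality forces \<open>f (k/q) = t + (1 - t) cos (2\<pi>k/q) =: w\<^sub>k\<close> on the grid of multiples of
  \<open>1/q\<close>. These values are \<open>1\<close> at \<open>k = 0\<close> and \<open>0\<close> at \<open>k = p, p + 1\<close>, and the piecewise linear
  interpolation of the grid values is then zero on all of \<open>[p/q, (p + 1)/q]\<close>. It is a sum of
  translates of the hat function of half-width \<open>1/q\<close>, so its cosine coefficients are those of the
  hat function multiplied by the discrete Fourier transform of \<open>w\<close>. The former are
  nonnegative, being squared sines up to positive factors, and the latter is nonnegative because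
  \<open>w\<close> is a nonnegative combination of the characters \<open>1\<close> and \<open>cos (2\<pi>k/q)\<close>. The constant
  coefficient is \<open>1/q \<sqdot> qt = t\<close> (\<open>extremal_function\<close>).

  What remains is that the hat function is the sum of its Fourier series
  (\<open>hat_cos_expansion\<close>). Its coefficients are summable, so the series has a continuous sum with
  the same coefficients, and a continuous function all of whose cosine coefficients vanish is zero
  (\<open>cos_moments_zero_imp_zero\<close>, by Stone--Weierstrass).
\<close>

section \<open>Uniqueness of cosine coefficients\<close>

text \<open>
  Say that \<open>v\<close> is a null function if all its cosine moments vanish. The continuous \<open>g\<close> for which
  multiplication by \<open>g\<close> preserves null functions form an algebra; it contains the constants, and
  \<open>cos (2\<pi>x)\<close> by the product-to-sum formula. Since \<open>cos (2\<pi>x)\<close> separates the points of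
  \<open>[0, 1/2]\<close>, Stone--Weierstrass approximates a null function \<open>u\<close> by such \<open>g\<close>. As \<open>\<integral>ug = 0\<close>,
  this makes \<open>\<integral>u\<^sup>2\<close> arbitrarily small.
\<close>

lemma cos_moments_zero_imp_zero:
  fixes u :: "real \<Rightarrow> real"
  assumes cont: "continuous_on {0..1/2} u"
    and moments: "\<And>m. ((\<lambda>x. u x * cos (2 * pi * real m * x)) has_integral 0) {0..1/2}"
    and x: "x \<in> {0..1/2}"
  shows "u x = 0"
proof -
  let ?S = "{0..1/2::real}"
  define Z where "Z v \<longleftrightarrow> continuous_on ?S v \<and>
      (\<forall>m. ((\<lambda>x. v x * cos (2 * pi * real m * x)) has_integral 0) ?S)" for v :: "real \<Rightarrow> real"
  define P where "P g \<longleftrightarrow> continuous_on ?S g \<and> (\<forall>v. Z v \<longrightarrow> Z (\<lambda>x. v x * g x))" for g :: "real \<Rightarrow> real"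
  have Zu: "Z u"
    using cont moments by (simp add: Z_def)
  have P_const: "P (\<lambda>x. c)" for c
  proof -
    have "((\<lambda>x. v x * c * cos (2 * pi * real m * x)) has_integral 0) ?S" if "Z v" for v m
    proof -
      have "((\<lambda>x. v x * cos (2 * pi * real m * x) * c) has_integral 0 * c) ?S"
        using that unfolding Z_def by (intro has_integral_mult_left) auto
      then show ?thesis
        by (simp add: mult_ac)
    qed
    then show ?thesis
      by (auto simp: P_def Z_def intro!: continuous_on_mult_right continuous_on_const)
  qed
  have P_add: "P (\<lambda>x. f x + g x)" if "P f" "P g" for f g
  proof -
    have "Z (\<lambda>x. v x * (f x + g x))" if "Z v" for v
    proof -
      have "Z (\<lambda>x. v x * f x)" "Z (\<lambda>x. v x * g x)"
        using \<open>P f\<close> \<open>P g\<close> that by (auto simp: P_def)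
      then have "((\<lambda>x. v x * f x * cos (2 * pi * real m * x) + v x * g x * cos (2 * pi * real m * x))
          has_integral 0 + 0) ?S" "continuous_on ?S (\<lambda>x. v x * f x + v x * g x)" for m
        unfolding Z_def by (intro has_integral_add continuous_on_add; blast)+
      then show ?thesis
        by (simp add: Z_def algebra_simps)
    qed
    then show ?thesis
      using that by (auto simp: P_def intro!: continuous_intros)
  qed
  have P_mult: "P (\<lambda>x. f x * g x)" if "P f" "P g" for f g
    using that unfolding P_def by (auto intro!: continuous_intros simp flip: mult.assoc)
  have P_cos: "P (\<lambda>x. cos (2 * pi * x))"
  proof -
    have "((\<lambda>x. v x * cos (2 * pi * x) * cos (2 * pi * real m * x)) has_integral 0) ?S" if "Z v" for v m
    proof (cases m)
      case 0
      with that show ?thesis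
        by (auto simp: Z_def dest: spec[of _ "1::nat"])
    next
      case (Suc k)
      have "((\<lambda>x. (v x * cos (2 * pi * real k * x) + v x * cos (2 * pi * real (Suc (Suc k)) * x)) / 2)
          has_integral (0 + 0) / 2) ?S"
        using that unfolding Z_def by (intro has_integral_divide has_integral_add) blast+
      moreover have "(v x * cos (2 * pi * real k * x) + v x * cos (2 * pi * real (Suc (Suc k)) * x)) / 2
          = v x * cos (2 * pi * x) * cos (2 * pi * real m * x)" for x
      proof -
        have "2 * pi * real k * x = 2 * pi * real m * x - 2 * pi * x"
          "2 * pi * real (Suc (Suc k)) * x = 2 * pi * real m * x + 2 * pi * x"
          using Suc by (simp_all add: algebra_simps)
        then show ?thesis
          by (simp only: cos_add cos_diff) (simp add: algebra_simps)
      qed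
      ultimately show ?thesis
        by (simp only: add_0 div_0)
    qed
    then show ?thesis
      by (auto simp: P_def Z_def intro!: continuous_intros)
  qed
  have separation: "\<exists>f. P f \<and> f x \<noteq> f y" if "x \<in> ?S \<and> y \<in> ?S \<and> x \<noteq> y" for x y
  proof -
    have "2 * pi * x \<in> {0..pi}" "2 * pi * y \<in> {0..pi}" "2 * pi * x \<noteq> 2 * pi * y"
      using that by auto
    then have "cos (2 * pi * x) \<noteq> cos (2 * pi * y)"
      using cos_inj_pi[of "2 * pi * x" "2 * pi * y"] by (metis atLeastAtMost_iff)
    with P_cos show ?thesis
      by blast
  qed
  have u2: "(\<lambda>x. (u x)\<^sup>2) integrable_on ?S"
    using cont by (intro integrable_continuous_real continuous_intros)
  have bound: "integral ?S (\<lambda>x. (u x)\<^sup>2) \<le> e" if "0 < e" for e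
  proof -
    have "\<exists>g. P g \<and> (\<forall>x\<in>?S. \<bar>u x - g x\<bar> < sqrt e)"
    proof (rule Stone_Weierstrass_HOL[where P = P])
      show "continuous_on ?S g" if "P g" for g
        using that by (simp add: P_def)
    qed (use that cont separation in \<open>blast intro: P_const P_add P_mult compact_Icc real_sqrt_gt_zero\<close>)+
    then obtain g where g: "P g" "\<And>x. x \<in> ?S \<Longrightarrow> \<bar>u x - g x\<bar> < sqrt e"
      by blast
    have "((\<lambda>x. u x * g x) has_integral 0) ?S"
      using g(1) Zu by (auto simp: P_def Z_def dest!: spec[of _ u] spec[of _ "0::nat"])
    then have "((\<lambda>x. 2 * (u x * g x) + e) has_integral 2 * 0 + e * (1/2 - 0)) ?S"
      using has_integral_const_real[of e 0 "1/2"]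
      by (intro has_integral_add has_integral_mult_right) (auto simp: mult.commute)
    \<comment> \<open>This is \<open>(u - g)\<^sup>2 \<le> e\<close> with the term \<open>g\<^sup>2\<close> dropped.\<close>
    moreover have "(u x)\<^sup>2 \<le> 2 * (u x * g x) + e" if "x \<in> ?S" for x
    proof -
      have "(u x - g x)\<^sup>2 \<le> (sqrt e)\<^sup>2"
        using g(2)[OF that] by (intro abs_le_square_iff[THEN iffD1]) auto
      then have "(u x - g x)\<^sup>2 \<le> e"
        using \<open>0 < e\<close> by simp
      moreover have "(u x)\<^sup>2 = 2 * (u x * g x) + (u x - g x)\<^sup>2 - (g x)\<^sup>2"
        by (simp add: power2_eq_square algebra_simps)
      ultimately show ?thesis
        using zero_le_power2[of "g x"] by linarith
    qed
    ultimately have "integral ?S (\<lambda>x. (u x)\<^sup>2) \<le> 2 * 0 + e * (1/2 - 0)"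
      using u2 by (intro has_integral_le[OF integrable_integral])
    then show ?thesis
      using that by simp
  qed
  have "integral ?S (\<lambda>x. (u x)\<^sup>2) \<le> 0"
    using bound by (rule field_le_epsilon[of _ 0, simplified])
  moreover have "integral ?S (\<lambda>x. (u x)\<^sup>2) \<ge> 0"
    using u2 by (intro integral_nonneg) auto
  ultimately have "\<forall>x\<in>?S. (u x)\<^sup>2 = 0"
    using cont by (subst integral_eq_0_iff[symmetric]) (auto intro!: continuous_intros)
  with x show ?thesis
    by auto
qed

section \<open>Properties of functions with a cosine expansion\<close>

lemma cos_expansion_periodic:
  assumes "cos_expansion f a"
  shows "f (x + 1) = f x"
proof -
  have "cos (2 * pi * real n * (x + 1)) = cos (2 * pi * real n * x)" for n
    using cos.plus_of_nat[of "2 * pi * real n * x" n] by (simp add: algebra_simps)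
  then show ?thesis
    using assms unfolding cos_expansion_def by (metis (no_types, lifting) sums_cong sums_unique2)
qed

lemma cos_expansion_even:
  assumes "cos_expansion f a"
  shows "f (- x) = f x"
  using assms sums_unique2[of "\<lambda>n. a n * cos (2 * pi * real n * x)" "f (- x)" "f x"]
  unfolding cos_expansion_def by (auto dest: spec[of _ "- x"])

lemma cos_expansion_continuous:
  assumes "cos_expansion f a"
  shows "continuous_on S f"
proof -
  have "uniform_limit S (\<lambda>N x. \<Sum>n<N. a n * cos (2 * pi * real n * x))
      (\<lambda>x. \<Sum>n. a n * cos (2 * pi * real n * x)) sequentially"
    using assms
    by (intro Weierstrass_m_test[where M = a])
      (auto simp: cos_expansion_def abs_mult sums_iff intro: mult_left_le)
  moreover have "(\<lambda>x. \<Sum>n. a n * cos (2 * pi * real n * x)) = f"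
    using assms by (auto simp: cos_expansion_def sums_iff)
  ultimately show ?thesis
    by (intro uniform_limit_theorem[where F = sequentially and
          f = "\<lambda>N x. \<Sum>n<N. a n * cos (2 * pi * real n * x)"])
      (auto intro!: always_eventually continuous_intros)
qed

text \<open>
  Continuity, periodicity and evenness come for free, so membership in \<^term>\<open>K h\<close> is only a matter
  of vanishing away from the origin.
\<close>
lemma cos_expansion_imp_K:
  assumes "cos_expansion f a"
    and "\<And>x. h \<le> \<bar>x\<bar> \<Longrightarrow> \<bar>x\<bar> \<le> 1/2 \<Longrightarrow> f x = 0"
  shows "f \<in> K h"
  using assms cos_expansion_periodic cos_expansion_even cos_expansion_continuous
  unfolding K_def by blast

lemma cos_expansion_has_integral_half:
  assumes "cos_expansion f a"
  shows "((\<lambda>x. f x * cos (2 * pi * real m * x)) has_integral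
          (if m = 0 then a 0 / 2 else a m / 4)) {0..1/2}"
proof -
  let ?g = "\<lambda>x. f x * cos (2 * pi * real m * x)"
  let ?I = "integral {0..1/2} ?g"
  have right: "(?g has_integral ?I) {0..1/2}"
    using cos_expansion_continuous[OF assms]
    by (intro integrable_integral integrable_continuous_real continuous_intros) auto
  then have "((\<lambda>x. ?g (- x)) has_integral ?I) {-(1/2)..-0}"
    by (rule has_integral_reflect_real[of ?g, THEN iffD2])
  then have left: "(?g has_integral ?I) {-1/2..0}"
    using cos_expansion_even[OF assms] by simp
  have "(?g has_integral ?I + ?I) {-1/2..1/2}"
    by (rule has_integral_combine[OF _ _ left right]) auto
  then have "?I + ?I = (if m = 0 then a 0 else a m / 2)"
    using cos_expansion_has_integral[OF assms] by (rule has_integral_unique)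
  then have "?I = (if m = 0 then a 0 / 2 else a m / 4)"
    by (auto split: if_splits)
  with right show ?thesis
    by (simp only:)
qed

section \<open>The Fourier series of the hat function\<close>

lemma hat_cos_moment:
  assumes d: "0 < d" "d \<le> 1/2"
  shows "((\<lambda>x. max 0 (1 - x / d) * cos (2 * pi * real m * x)) has_integral
          (if m = 0 then d / 2 else (1 - cos (2 * pi * real m * d)) / (d * (2 * pi * real m)\<^sup>2))) {0..1/2}"
proof -
  let ?I = "if m = 0 then d / 2 else (1 - cos (2 * pi * real m * d)) / (d * (2 * pi * real m)\<^sup>2)"
  have "((\<lambda>x. (1 - x / d) * cos (2 * pi * real m * x)) has_integral ?I) {0..d}"
  proof (cases "m = 0")
    case True
    have "((\<lambda>x. 1 - x / d) has_integral (d - d\<^sup>2 / (2 * d)) - (0 - 0\<^sup>2 / (2 * d))) {0..d}"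
      using d by (intro fundamental_theorem_of_calculus)
        (auto intro!: derivative_eq_intros simp flip: has_real_derivative_iff_has_vector_derivative)
    with True d show ?thesis
      by (simp add: power2_eq_square)
  next
    case False
    define w where "w = 2 * pi * real m"
    let ?F = "\<lambda>x. (1 - x / d) * sin (w * x) / w - cos (w * x) / (d * w\<^sup>2)"
    have w: "w \<noteq> 0"
      using False by (simp add: w_def)
    have "((\<lambda>x. (1 - x / d) * cos (w * x)) has_integral ?F d - ?F 0) {0..d}"
      using d w by (intro fundamental_theorem_of_calculus)
        (auto intro!: derivative_eq_intros simp: field_simps power2_eq_square
          simp flip: has_real_derivative_iff_has_vector_derivative)
    moreover have "?F d - ?F 0 = (1 - cos (w * d)) / (d * w\<^sup>2)"
      using d by (simp add: diff_divide_distrib)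
    ultimately show ?thesis
      using False by (simp add: w_def)
  qed
  then have "((\<lambda>x. if x \<in> {0..d} then (1 - x / d) * cos (2 * pi * real m * x) else 0) has_integral ?I) {0..1/2}"
    using d by (subst has_integral_restrict) auto
  then show ?thesis
    by (rule has_integral_eq[rotated]) (use d in \<open>auto simp: max_def field_simps\<close>)
qed

text \<open>
  The function \<open>L\<close> is the periodic hat function with value \<open>1 - \<bar>x\<bar>/d\<close> for \<open>\<bar>x\<bar> \<le> d\<close>, whose mean
  is \<open>d\<close>; only its value at \<open>0\<close> (part of \<^const>\<open>cos_expansion\<close>), its zeros and its mean are
  recorded. It is constructed as the sum of the expected series, and uniqueness of cosine
  coefficients then identifies that sum with the hat function.
\<close>
lemma hat_cos_expansion:
  assumes d: "0 < d" "d \<le> 1/2"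
  obtains L b where "cos_expansion L b" "b 0 = d"
    "\<And>x. d \<le> \<bar>x\<bar> \<Longrightarrow> \<bar>x\<bar> \<le> 1/2 \<Longrightarrow> L x = 0"
proof -
  define c where "c n = (if n = 0 then d else 4 * (1 - cos (2 * pi * real n * d)) / (d * (2 * pi * real n)\<^sup>2))" for n
  \<comment> \<open>The sum of the coefficients must be \<open>1\<close>, but this follows only from the pointwise identity at
    \<open>0\<close> established below; until then the series is normalised by \<open>s\<close>.\<close>
  define s where "s = suminf c"
  define b where "b n = c n / s" for n
  define L where "L x = (\<Sum>n. b n * cos (2 * pi * real n * x))" for x
  have c_nonneg: "0 \<le> c n" for n
    using d by (auto simp: c_def intro!: divide_nonneg_nonneg mult_nonneg_nonneg)
  have "norm (c (Suc n)) \<le> 2 / (d * pi\<^sup>2) * inverse (real (Suc n) ^ 2)" for n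
  proof -
    have "c (Suc n) = (1 - cos (2 * pi * real (Suc n) * d)) / (d * pi\<^sup>2 * real (Suc n) ^ 2)"
      unfolding c_def power_mult_distrib
      using mult_divide_mult_cancel_left[of 4 "1 - cos (2 * pi * real (Suc n) * d)" "d * pi\<^sup>2 * real (Suc n) ^ 2"]
      by (simp add: mult_ac del: of_nat_Suc)
    also have "\<dots> \<le> 2 / (d * pi\<^sup>2 * real (Suc n) ^ 2)"
      using d cos_ge_minus_one[of "2 * pi * real (Suc n) * d"]
      by (intro divide_right_mono) (auto simp del: of_nat_Suc)
    finally show ?thesis
      using c_nonneg[of "Suc n"] by (simp add: field_simps del: of_nat_Suc)
  qed
  moreover have "summable (\<lambda>n. 2 / (d * pi\<^sup>2) * inverse (real (Suc n) ^ 2))"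
    using inverse_power_summable[of 2, where 'a = real]
    by (intro summable_mult) (subst summable_Suc_iff, simp)
  ultimately have "summable (\<lambda>n. c (Suc n))"
    by (rule summable_comparison_test'[rotated])
  then have summable_c: "summable c"
    by (subst (asm) summable_Suc_iff)
  have "0 < s"
    unfolding s_def using summable_c c_nonneg d by (intro suminf_pos2[of _ 0]) (auto simp: c_def)
  have b_sums: "b sums 1"
    using sums_divide[OF summable_sums[OF summable_c], of s] \<open>0 < s\<close> by (simp add: b_def[abs_def] s_def)
  have b_nonneg: "0 \<le> b n" for n
    using c_nonneg \<open>0 < s\<close> by (simp add: b_def)
  have "summable (\<lambda>n. b n * cos (2 * pi * real n * x))" for x
  proof (rule summable_comparison_test')
    show "summable b"
      using b_sums by (rule sums_summable)
    show "norm (b n * cos (2 * pi * real n * x)) \<le> b n" for n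
      using b_nonneg by (simp add: abs_mult mult_left_le)
  qed
  then have "(\<lambda>n. b n * cos (2 * pi * real n * x)) sums L x" for x
    unfolding L_def by (rule summable_sums)
  moreover have "L 0 = 1"
    unfolding L_def using b_sums by (simp add: sums_iff)
  ultimately have L: "cos_expansion L b"
    using b_sums b_nonneg by (simp add: cos_expansion_def)
  have hat: "s * L x = max 0 (1 - x / d)" if "x \<in> {0..1/2}" for x
  proof -
    have "((\<lambda>x. (s * L x - max 0 (1 - x / d)) * cos (2 * pi * real m * x)) has_integral 0) {0..1/2}" for m
    proof -
      have "((\<lambda>x. s * (L x * cos (2 * pi * real m * x)) - max 0 (1 - x / d) * cos (2 * pi * real m * x))
        has_integral s * (if m = 0 then b 0 / 2 else b m / 4) -
          (if m = 0 then d / 2 else (1 - cos (2 * pi * real m * d)) / (d * (2 * pi * real m)\<^sup>2))) {0..1/2}"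
        by (intro has_integral_diff has_integral_mult_right cos_expansion_has_integral_half L hat_cos_moment d)
      moreover have "s * (if m = 0 then b 0 / 2 else b m / 4) =
          (if m = 0 then d / 2 else (1 - cos (2 * pi * real m * d)) / (d * (2 * pi * real m)\<^sup>2))"
      proof -
        have "s * (if m = 0 then b 0 / 2 else b m / 4) = (if m = 0 then c 0 / 2 else c m / 4)"
          using \<open>0 < s\<close> by (simp add: b_def)
        moreover have "4 * X / Y / 4 = X / Y" for X Y :: real
          by simp
        ultimately show ?thesis
          by (cases "m = 0") (simp_all only: c_def if_True if_False simp_thms)
      qed
      ultimately show ?thesis
        by (simp only: left_diff_distrib mult.assoc diff_self)
    qed
    moreover have "continuous_on {0..1/2} (\<lambda>x. s * L x - max 0 (1 - x / d))"
      using d cos_expansion_continuous[OF L] by (auto intro!: continuous_intros)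
    ultimately have "s * L x - max 0 (1 - x / d) = 0"
      using that by (intro cos_moments_zero_imp_zero[of "\<lambda>x. s * L x - max 0 (1 - x / d)"])
    then show ?thesis
      by simp
  qed
  have "s = 1"
    using hat[of 0] L by (simp add: cos_expansion_def)
  show thesis
  proof
    show "cos_expansion L b" by fact
    show "b 0 = d"
      using \<open>s = 1\<close> by (simp add: b_def c_def)
    show "L x = 0" if "d \<le> \<bar>x\<bar>" "\<bar>x\<bar> \<le> 1/2" for x
    proof -
      have "L x = L \<bar>x\<bar>"
        using cos_expansion_even[OF L] by (simp add: abs_if)
      also have "\<dots> = max 0 (1 - \<bar>x\<bar> / d)"
        using hat[of "\<bar>x\<bar>"] that \<open>s = 1\<close> by simp
      also have "\<dots> = 0"
        using that d by (simp add: max_def)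
      finally show ?thesis .
    qed
  qed
qed

section \<open>Cosines on the grid of a regular polygon\<close>

lemma sum_cos_multiples:
  assumes "q > 0"
  shows "(\<Sum>k<q. cos (2 * pi * of_int m * real k / real q)) =
    (if int q dvd m then real q else 0)"
proof -
  define z where "z = cis (2 * pi * of_int m / real q)"
  have "(\<Sum>k<q. cos (2 * pi * of_int m * real k / real q)) = Re (\<Sum>k<q. z ^ k)"
    by (simp add: z_def Complex.DeMoivre mult_ac)
  also have "(\<Sum>k<q. z ^ k) = (if z = 1 then of_nat q else (1 - z ^ q) / (1 - z))"
    by (rule sum_gp_strict)
  also have "z ^ q = 1"
    using assms by (simp add: z_def Complex.DeMoivre cis_multiple_2pi)
  also have "z = 1 \<longleftrightarrow> int q dvd m"
  proof
    assume "z = 1"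
    then have "cos (2 * pi * of_int m / real q) = 1"
      by (simp add: z_def complex_eq_iff)
    then obtain n where "2 * pi * of_int m / real q = of_int n * 2 * pi"
      by (auto simp: cos_one_2pi_int)
    then have "real_of_int m = real_of_int (n * int q)"
      using assms by (simp add: field_simps)
    then have "m = n * int q"
      by (simp only: of_int_eq_iff)
    then show "int q dvd m"
      by simp
  next
    assume "int q dvd m"
    then obtain n where "m = int q * n"
      by blast
    then have "z = cis (2 * pi * of_int n)"
      using assms by (simp add: z_def field_simps)
    then show "z = 1"
      by (simp add: cis_multiple_2pi)
  qed
  finally show ?thesis
    by simp
qed

text \<open>
  Modulo \<open>2\<pi>\<close> and up to sign the angle is \<open>2\<pi>l/q\<close> with an integer \<open>l \<le> p\<close>. On \<open>[0, \<pi>]\<close> the cosine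
  decreases, so \<open>l = p\<close> is the worst case, where the angle is \<open>\<pi> - \<pi>/q\<close>.
\<close>
lemma cos_multiples_ge:
  fixes p n :: nat
  defines "q \<equiv> 2 * real p + 1"
  shows "- cos (pi / q) \<le> cos (2 * pi * real n * (real p / q))"
proof -
  define k where "k = (n * p) mod (2 * p + 1)"
  define l where "l = min k (2 * p + 1 - k)"
  have q: "q > 0" "real (2 * p + 1) = q"
    by (simp_all add: q_def)
  have k: "k < 2 * p + 1"
    by (simp add: k_def)
  have "real n * real p = real ((2 * p + 1) * ((n * p) div (2 * p + 1)) + k)"
    unfolding k_def by (simp only: mult_div_mod_eq of_nat_mult)
  then have np: "real n * real p = q * real ((n * p) div (2 * p + 1)) + real k"
    by (simp add: q_def algebra_simps)
  have "2 * pi * real n * (real p / q) = 2 * pi * (real n * real p) / q"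
    by simp
  also have "\<dots> = 2 * pi * real k / q + 2 * pi * real ((n * p) div (2 * p + 1))"
    unfolding np using q(1) by (simp add: distrib_left add_divide_distrib)
  finally have "cos (2 * pi * real n * (real p / q)) =
      cos (2 * pi * real k / q + 2 * pi * real ((n * p) div (2 * p + 1)))"
    by (rule arg_cong)
  also have "\<dots> = cos (2 * pi * real k / q)"
    using cos.plus_of_nat[of "2 * pi * real k / q" "(n * p) div (2 * p + 1)"] by (simp add: mult_ac)
  also have "\<dots> = cos (2 * pi * real l / q)"
  proof (cases "l = k")
    case False
    then have "real l = q - real k"
      using k by (auto simp: l_def q_def min_def of_nat_diff split: if_splits)
    then have "cos (2 * pi * real l / q) = cos (2 * pi - 2 * pi * real k / q)"
      using q(1) by (simp add: right_diff_distrib diff_divide_distrib)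
    then show ?thesis
      by simp
  qed simp
  also have "\<dots> \<ge> cos (pi - pi / q)"
  proof (intro cos_monotone_0_pi_le)
    have "l \<le> p"
      by (auto simp: l_def)
    then have "2 * real l \<le> q - 1"
      by (simp add: q_def)
    then have "pi * (2 * real l) \<le> pi * (q - 1)"
      by (intro mult_left_mono) auto
    then show "2 * pi * real l / q \<le> pi - pi / q"
      using q by (simp add: field_simps)
  qed (use q in auto)
  finally show ?thesis
    by simp
qed

section \<open>The extremal problem\<close>

text \<open>
  In the series for \<open>f x + C = C\<close> at \<open>x = p/(2p + 1)\<close> all terms
  \<open>a\<^sub>n (cos (2\<pi>nx) + C)\<close> are nonnegative, so the term for \<open>n = 0\<close> is at most the sum.
\<close>
lemma constant_coeff_le:
  fixes p :: nat
  assumes p: "p \<ge> 1" and f: "f \<in> K (real p / (2 * real p + 1))" and a: "cos_expansion f a"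
  shows "a 0 \<le> cos (pi / (2 * real p + 1)) / (1 + cos (pi / (2 * real p + 1)))"
proof -
  define x where "x = real p / (2 * real p + 1)"
  define C where "C = cos (pi / (2 * real p + 1))"
  have "C > 0"
  proof -
    have "pi / (2 * real p + 1) < pi / 2"
      using p by (intro divide_strict_left_mono) auto
    then show ?thesis
      unfolding C_def by (intro cos_gt_zero) auto
  qed
  have "f x = 0"
  proof -
    have "0 \<le> x" "x \<le> 1/2"
      by (simp_all add: x_def field_simps)
    then show ?thesis
      using f unfolding x_def[symmetric] by (simp add: K_def)
  qed
  moreover have "(\<lambda>n. a n * cos (2 * pi * real n * x)) sums f x" "a sums 1"
    using a by (simp_all add: cos_expansion_def)
  ultimately have "(\<lambda>n. a n * cos (2 * pi * real n * x) + a n * C) sums (0 + 1 * C)"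
    by (intro sums_add sums_mult2) simp_all
  then have sums: "(\<lambda>n. a n * (cos (2 * pi * real n * x) + C)) sums C"
    by (simp add: algebra_simps)
  have "0 \<le> a n * (cos (2 * pi * real n * x) + C)" for n
    using a cos_multiples_ge[of p n] by (auto simp: cos_expansion_def x_def C_def intro!: mult_nonneg_nonneg)
  then have "(\<Sum>n\<in>{0}. a n * (cos (2 * pi * real n * x) + C)) \<le>
      (\<Sum>n. a n * (cos (2 * pi * real n * x) + C))"
    using sums by (intro sum_le_suminf) (auto dest: sums_summable)
  also have "\<dots> = C"
    using sums by (rule sums_unique[symmetric])
  finally have "(\<Sum>n\<in>{0}. a n * (cos (2 * pi * real n * x) + C)) \<le> C" .
  then have "a 0 * (1 + C) \<le> C"
    by simp
  then show ?thesis
    using \<open>C > 0\<close> unfolding C_def[symmetric] by (simp add: field_simps)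
qed

text \<open>
  The witness interpolates \<open>w\<^sub>k\<close> at \<open>\<plusminus>k/q\<close> by hats. Every point of \<open>[p/q, 1/2]\<close> is at distance at
  least \<open>1/q\<close>, modulo \<open>1\<close>, from all grid points except \<open>p/q\<close> and \<open>(p + 1)/q\<close>, where the weights
  vanish.
\<close>
lemma extremal_function:
  fixes p :: nat
  assumes p: "p \<ge> 1"
  obtains f a where "f \<in> K (real p / (2 * real p + 1))" "cos_expansion f a"
    "a 0 = cos (pi / (2 * real p + 1)) / (1 + cos (pi / (2 * real p + 1)))"
proof -
  define q where "q = 2 * p + 1"
  define C where "C = cos (pi / real q)"
  define t where "t = C / (1 + C)"
  define w where "w k = t + (1 - t) * cos (2 * pi * real k / real q)" for k :: nat
  have q: "q \<ge> 3" "real q = 2 * real p + 1"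
    using p by (simp_all add: q_def)
  have "C > 0"
  proof -
    have "pi / real q < pi / 2"
      using q(1) by (intro divide_strict_left_mono) auto
    then show ?thesis
      unfolding C_def using q(1) by (intro cos_gt_zero) auto
  qed
  have t: "0 \<le> t" "t \<le> 1" "t = (1 - t) * C"
    using \<open>C > 0\<close> by (auto simp: t_def field_simps)
  have w0: "w 0 = 1"
    by (simp add: w_def)
  have "2 * pi * real p / real q = pi - pi / real q" "2 * pi * real (Suc p) / real q = pi + pi / real q"
    by (simp_all add: q(2) field_simps)
  then have w_zero: "w p = 0" "w (Suc p) = 0"
    using t(3) unfolding w_def C_def by (simp_all del: of_nat_Suc)
  have "0 < 1 / real q" "1 / real q \<le> 1 / 2"
    using q(1) by (auto simp: field_simps)
  then obtain L b where L: "cos_expansion L b" "b 0 = 1 / real q"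
    and L_zero: "\<And>x. 1 / real q \<le> \<bar>x\<bar> \<Longrightarrow> \<bar>x\<bar> \<le> 1/2 \<Longrightarrow> L x = 0"
    using hat_cos_expansion by blast
  have L_even: "L (- x) = L x" and L_periodic: "L (x + 1) = L x" for x
    using cos_expansion_even[OF L(1)] cos_expansion_periodic[OF L(1)] by auto
  have L_gap: "L x = 0" if "1 \<le> real q * x" "real q * x \<le> real q - 1" for x
  proof (cases "x \<le> 1/2")
    case True
    have "1 / real q \<le> x"
      using that q(1) by (simp add: field_simps)
    moreover from this have "\<bar>x\<bar> = x"
      using \<open>0 < 1 / real q\<close> by linarith
    ultimately show ?thesis
      using True by (intro L_zero) auto
  next
    case False
    have "1 / real q \<le> 1 - x"
      using that q(1) by (simp add: field_simps)
    moreover from this have "\<bar>1 - x\<bar> = 1 - x"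
      using \<open>0 < 1 / real q\<close> by linarith
    ultimately have "L (1 - x) = 0"
      using False by (intro L_zero) auto
    then show ?thesis
      using L_periodic[of "- x"] L_even[of x] by simp
  qed
  have L_gap': "L x = 0" if "- (real q - 1) \<le> real q * x" "real q * x \<le> - 1" for x
    using L_gap[of "- x"] that L_even[of x] by simp
  \<comment> \<open>The weights satisfy \<open>w\<^sub>q\<^sub>-\<^sub>k = w\<^sub>k\<close>, so averaging over \<open>\<plusminus>k\<close> does not change the sum of translates;
    it makes the sine terms cancel term by term.\<close>
  define f where "f x = (\<Sum>k<q. w k * ((L (x - real k / real q) + L (x + real k / real q)) / 2))" for x
  define D where "D n = (\<Sum>k<q. w k * cos (2 * pi * real n * real k / real q))" for n :: nat
  define a where "a n = b n * D n" for n
  have f_sums: "(\<lambda>n. a n * cos (2 * pi * real n * x)) sums f x" for x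
  proof -
    have "(\<lambda>n. \<Sum>k<q. w k * ((b n * cos (2 * pi * real n * (x - real k / real q)) +
        b n * cos (2 * pi * real n * (x + real k / real q))) / 2)) sums f x"
      unfolding f_def using L(1)
      by (intro sums_sum sums_mult sums_divide sums_add) (auto simp: cos_expansion_def)
    moreover have "(\<Sum>k<q. w k * ((b n * cos (2 * pi * real n * (x - real k / real q)) +
        b n * cos (2 * pi * real n * (x + real k / real q))) / 2)) = a n * cos (2 * pi * real n * x)" for n
      unfolding a_def D_def sum_distrib_left sum_distrib_right
      by (intro sum.cong) (simp_all add: right_diff_distrib distrib_left cos_add cos_diff)
    ultimately show ?thesis
      by simp
  qed
  have f0: "f 0 = 1"
  proof -
    have "L (0 - real k / real q) = 0" "L (0 + real k / real q) = 0" if "k < q" "k \<noteq> 0" for k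
      using that L_gap[of "real k / real q"] L_even[of "real k / real q"] by auto
    then have "f 0 = (\<Sum>k<q. if k = 0 then w 0 * L 0 else 0)"
      unfolding f_def by (intro sum.cong) auto
    then show ?thesis
      using q(1) w0 L(1) by (simp add: cos_expansion_def)
  qed
  have cos_sum_nonneg: "0 \<le> (\<Sum>k<q. cos (2 * pi * of_int m * real k / real q))" for m
    using q(1) by (subst sum_cos_multiples) auto
  \<comment> \<open>The product of cosines in \<open>D n\<close> splits into the frequencies \<open>n - 1\<close> and \<open>n + 1\<close>; integer
    frequencies accommodate \<open>n = 0\<close>.\<close>
  have D: "D n = t * (\<Sum>k<q. cos (2 * pi * of_int (int n) * real k / real q)) +
      (1 - t) / 2 * ((\<Sum>k<q. cos (2 * pi * of_int (int n - 1) * real k / real q)) +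
        (\<Sum>k<q. cos (2 * pi * of_int (int n + 1) * real k / real q)))" for n
    unfolding D_def w_def sum_distrib_left sum.distrib[symmetric]
    by (intro sum.cong)
      (simp_all add: algebra_simps add_divide_distrib diff_divide_distrib cos_add cos_diff)
  have D_nonneg: "0 \<le> D n" for n
    unfolding D using t(1,2) by (intro add_nonneg_nonneg mult_nonneg_nonneg cos_sum_nonneg) auto
  have D0: "D 0 = t * real q"
  proof -
    have "\<not> int q dvd 1" "\<not> int q dvd - 1"
      using q(1) by auto
    then show ?thesis
      using q(1) unfolding D by (subst sum_cos_multiples, simp)+ auto
  qed
  have f: "cos_expansion f a"
  proof -
    have "a sums 1"
      using f_sums[of 0] f0 by simp
    moreover have "0 \<le> a n" for n
      using L(1) D_nonneg by (simp add: a_def cos_expansion_def)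
    ultimately show ?thesis
      using f_sums f0 by (simp add: cos_expansion_def)
  qed
  have f_zero: "f x = 0" if x: "real p / real q \<le> x" "x \<le> 1/2" for x
    unfolding f_def
  proof (rule sum.neutral, intro ballI)
    fix k assume "k \<in> {..<q}"
    then have k: "k \<le> 2 * p"
      by (simp add: q_def)
    have qx: "real p \<le> real q * x" "real q * x \<le> real p + 1"
    proof -
      show "real p \<le> real q * x"
        using mult_left_mono[OF x(1), of "real q"] q by simp
      have "real q * x \<le> real q * (1/2)"
        using x(2) by (intro mult_left_mono) auto
      also have "\<dots> \<le> real p + 1"
        unfolding q(2) by simp
      finally show "real q * x \<le> real p + 1" .
    qed
    have qk: "real q * (x - real k / real q) = real q * x - real k"
      "real q * (x + real k / real q) = real q * x + real k"
      "real q * (x + real k / real q - 1) = real q * x + real k - real q"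
      using q(1) by (auto simp: field_simps)
    consider "k < p" | "k = p" | "k = Suc p" | "k > Suc p"
      by linarith
    then show "w k * ((L (x - real k / real q) + L (x + real k / real q)) / 2) = 0"
    proof cases
      case 1
      then have "real k + 1 \<le> real p" by linarith
      with p have "L (x - real k / real q) = 0" "L (x + real k / real q) = 0"
        by (intro L_gap; unfold qk; use qx q(2) in linarith)+
      then show ?thesis by simp
    next
      case 4
      then have "real p + 2 \<le> real k" "real k \<le> 2 * real p" using k by linarith+
      with p have "L (x - real k / real q) = 0"
        by (intro L_gap'; unfold qk; use qx q(2) in linarith)
      moreover from 4 p \<open>real p + 2 \<le> real k\<close> \<open>real k \<le> 2 * real p\<close>
      have "L (x + real k / real q - 1) = 0"
        by (intro L_gap; unfold qk; use qx q(2) in linarith)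
      ultimately show ?thesis
        using L_periodic[of "x + real k / real q - 1"] by simp
    qed (use w_zero in simp_all)
  qed
  show thesis
  proof
    show "f \<in> K (real p / (2 * real p + 1))"
    proof (rule cos_expansion_imp_K[OF f])
      fix x :: real
      assume "real p / (2 * real p + 1) \<le> \<bar>x\<bar>" "\<bar>x\<bar> \<le> 1/2"
      then have "f \<bar>x\<bar> = 0"
        using q(2) by (intro f_zero) auto
      then show "f x = 0"
        using cos_expansion_even[OF f, of x] by (simp add: abs_if split: if_splits)
    qed
    show "cos_expansion f a" by fact
    show "a 0 = cos (pi / (2 * real p + 1)) / (1 + cos (pi / (2 * real p + 1)))"
      using q by (simp add: a_def L(2) D0 t_def C_def)
  qed
qed

theorem theorem4:
  fixes p :: nat
  assumes "p \<ge> 1"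
  shows "A (real p / (2 * real p + 1)) =
           cos (pi / (2 * real p + 1)) / (1 + cos (pi / (2 * real p + 1)))"
proof -
  let ?h = "real p / (2 * real p + 1)"
  let ?v = "cos (pi / (2 * real p + 1)) / (1 + cos (pi / (2 * real p + 1)))"
  obtain f a where "f \<in> K ?h" "cos_expansion f a" "a 0 = ?v"
    using extremal_function[OF assms] .
  then have "?v \<in> {a 0 | f a. f \<in> K ?h \<and> cos_expansion f a}"
    unfolding mem_Collect_eq by (intro exI[of _ f] exI[of _ a]) simp
  then show ?thesis
    unfolding A_def
  proof (rule cSup_eq_maximum)
    fix y assume "y \<in> {a 0 | f a. f \<in> K ?h \<and> cos_expansion f a}"
    then obtain g b where "y = b 0" "g \<in> K ?h" "cos_expansion g b"
      by blast
    then show "y \<le> ?v"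
      using constant_coeff_le[OF assms] by simp
  qed
qed

end
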